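(* Let $\varepsilon>0$. Suppose the initial data for the inviscid CP model with parameter $\varepsilon$ corresponds to the non-negative random variable $X_0$ (that is, $v_\varepsilon(x,0)=1/E[X_0-x\mid X_0>x]$ for $0\le x<\|X_0\|_\infty$), and assume that $$\varepsilon<\langle X_0\rangle,\qquad \|X_0\|_\infty<\infty,\qquad x\mapsto E[X_0-x\mid X_0>x]\ \text{ is decreasing for } 0\le x<\|X_0\|_\infty .$$ Let $X_t$, $t\ge 0$, be the random variables given by the evolution of the inviscid CP model. Then $\lim_{t\to\infty}\langle X_t\rangle/t=1$. If in addition the function $x\mapsto E[X_0-x\mid X_0>x]$ is $C^1$ and convex for $x$ close to $\|X_0\|_\infty$ with $$\liminf_{x\to\|X_0\|_\infty}\ \frac{\partial}{\partial x}\,\frac{1}{E[X_0-x\mid X_0>x]}\ >\ 0,$$ then there exist $C,T>0$ such that $$1-\frac{C}{\log t}\ \le\ \frac{d}{dt}\langle X_t\rangle\ \le\ 1\qquad\text{for } t\ge T .$$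
   Context: "Increasing" and "decreasing" are meant in the non-strict sense. $\langle X\rangle$ is the mean of $X$ and $\|X\|_\infty$ its essential supremum. For a continuous $A\ge 0$ put $$m_{1,A}(t)=e^{\int_0^tA(s)ds},\quad m_{2,A}(t)=\int_0^t e^{\int_s^tA(s')ds'}ds,\quad \sigma_A^2(t)=\int_0^t e^{2\int_s^tA(s')ds'}ds .$$ The inviscid CP model with parameter $\varepsilon$ is the system for $v_\varepsilon(x,t)$ and $\Lambda_\varepsilon(t)>0$ ($x\ge 0$, $t\ge 0$): $$\frac{\partial v_\varepsilon}{\partial t}+\Big[\frac{x}{\Lambda_\varepsilon(t)}-1+\varepsilon v_\varepsilon\Big]\frac{\partial v_\varepsilon}{\partial x}+\frac{v_\varepsilon}{\Lambda_\varepsilon(t)}=0,\qquad v_\varepsilon(0,t)=\frac1{\Lambda_\varepsilon(t)} .$$ For initial data $v_0:[0,x_\infty)\to(0,\infty)$ ($0<x_\infty\le\infty$) that is continuous and increasing, the solution is understood through the method of characteristics: $\Lambda_\varepsilon:[0,\infty)\to(0,\infty)$ is continuous and, with $A=1/\Lambda_\varepsilon$, $$v_\varepsilon(x,t)=\frac{v_0(z(x,t))}{m_{1,A}(t)},$$ where $z=z(x,t)\in[0,x_\infty)$ is the unique solution of $$z+\varepsilon\frac{\sigma_A^2(t)}{m_{1,A}(t)^2}v_0(z)=\frac{x+m_{2,A}(t)}{m_{1,A}(t)},$$ and $v_\varepsilon(0,t)=1/\Lambda_\varepsilon(t)$ for all $t\ge 0$. Correspondence with random variables: $v_\varepsilon(\cdot,t)$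 corresponds to the non-negative random variable $X_t$ with $v_\varepsilon(x,t)=1/E[X_t-x\mid X_t>x]$, so $\langle X_t\rangle=\Lambda_\varepsilon(t)$. In the present statement $x_\infty=\|X_0\|_\infty$; under the stated hypotheses the solution exists globally in time and is unique. *)

theory Defs
  imports "HOL-Probability.Probability"
begin

text \<open>The mean residual life \<open>E[X - x | X > x]\<close>, as an expectation under the
  conditional measure. It is meaningful for \<open>P(X > x) > 0\<close>, in particular for
  \<open>0 \<le> x < \<parallel>X\<parallel>\<^sub>\<infinity>\<close> when \<open>X \<ge> 0\<close>.\<close>

definition mean_residual :: "'a measure \<Rightarrow> ('a \<Rightarrow> real) \<Rightarrow> real \<Rightarrow> real" where
  "mean_residual M X x =
     (\<integral>\<omega>. X \<omega> - x \<partial>uniform_measure M {\<omega> \<in> space M. X \<omega> > x})"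

definition ess_norm :: "'a measure \<Rightarrow> ('a \<Rightarrow> real) \<Rightarrow> ereal" where
  "ess_norm M X = esssup M (\<lambda>\<omega>. ereal \<bar>X \<omega>\<bar>)"

definition m1 :: "(real \<Rightarrow> real) \<Rightarrow> real \<Rightarrow> real" where
  "m1 A t = exp (integral {0..t} A)"

definition m2 :: "(real \<Rightarrow> real) \<Rightarrow> real \<Rightarrow> real" where
  "m2 A t = integral {0..t} (\<lambda>s. exp (integral {s..t} A))"

definition sigma_sq :: "(real \<Rightarrow> real) \<Rightarrow> real \<Rightarrow> real" where
  "sigma_sq A t = integral {0..t} (\<lambda>s. exp (2 * integral {s..t} A))"

text \<open>The characteristic through \<open>(x, t)\<close> starts at \<open>z \<in> [0, x\<^sub>\<infinity>)\<close>.\<close>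

definition CP_char ::
  "real \<Rightarrow> ereal \<Rightarrow> (real \<Rightarrow> real) \<Rightarrow> (real \<Rightarrow> real) \<Rightarrow> real \<Rightarrow> real \<Rightarrow> real \<Rightarrow> bool" where
  "CP_char \<epsilon> x_inf v0 A x t z \<longleftrightarrow>
     0 \<le> z \<and> ereal z < x_inf \<and>
     z + \<epsilon> * (sigma_sq A t / (m1 A t)\<^sup>2) * v0 z = (x + m2 A t) / m1 A t"

text \<open>The set of \<open>x \<ge> 0\<close> at which \<open>v(\<cdot>, t)\<close> is defined by characteristics. It is
  \<open>[0, x\<^sub>\<infinity>)\<close> at \<open>t = 0\<close>, but may be larger or smaller at later times.\<close>

definition CP_domain ::
  "real \<Rightarrow> ereal \<Rightarrow> (real \<Rightarrow> real) \<Rightarrow> (real \<Rightarrow> real) \<Rightarrow> real \<Rightarrow> real set" where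
  "CP_domain \<epsilon> x_inf v0 A t = {x. 0 \<le> x \<and> (\<exists>!z. CP_char \<epsilon> x_inf v0 A x t z)}"

text \<open>Solutions of the inviscid CP model with initial data \<open>v0\<close> on \<open>[0, x\<^sub>\<infinity>)\<close>, global in
  time. The HOL function \<open>v\<close> is total; its values outside the domain are irrelevant.\<close>

definition inviscid_CP_solution ::
  "real \<Rightarrow> ereal \<Rightarrow> (real \<Rightarrow> real) \<Rightarrow> (real \<Rightarrow> real) \<Rightarrow> (real \<Rightarrow> real \<Rightarrow> real) \<Rightarrow> bool" where
  "inviscid_CP_solution \<epsilon> x_inf v0 \<Lambda> v \<longleftrightarrow>
     (let A = (\<lambda>t. 1 / \<Lambda> t) in
        continuous_on {0..} \<Lambda> \<and>
        (\<forall>t\<ge>0. 0 < \<Lambda> t) \<and>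
        (\<forall>t\<ge>0. \<forall>x\<in>CP_domain \<epsilon> x_inf v0 A t.
           v x t = v0 (THE z. CP_char \<epsilon> x_inf v0 A x t z) / m1 A t) \<and>
        (\<forall>t\<ge>0. 0 \<in> CP_domain \<epsilon> x_inf v0 A t \<and> v 0 t = 1 / \<Lambda> t))"

text \<open>The function \<open>f\<close> with domain \<open>D\<close> corresponds to the non-negative random variable \<open>X\<close>.\<close>

definition CP_corresponds ::
  "'a measure \<Rightarrow> ('a \<Rightarrow> real) \<Rightarrow> real set \<Rightarrow> (real \<Rightarrow> real) \<Rightarrow> bool" where
  "CP_corresponds M X D f \<longleftrightarrow>
     X \<in> borel_measurable M \<and> (AE \<omega> in M. 0 \<le> X \<omega>) \<and>
     D = {x. 0 \<le> x \<and> ereal x < ess_norm M X} \<and>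
     (\<forall>x\<in>D. f x = 1 / mean_residual M X x)"

text \<open>The random variables \<open>X t\<close> given by the evolution from \<open>X 0\<close>. At \<open>x = 0\<close> the
  correspondence only fixes \<open>E[X\<^sub>t | X\<^sub>t > 0]\<close>, so it does not see an atom of \<open>X\<^sub>t\<close> at 0.
  The convention is that \<open>X\<^sub>t\<close> has none for \<open>t > 0\<close>, so that \<open>\<langle>X\<^sub>t\<rangle> = 1 / v(0, t) = \<Lambda>(t)\<close>.
  The initial variable \<open>X 0\<close> may have one.\<close>

definition CP_evolution ::
  "'a measure \<Rightarrow> real \<Rightarrow> (real \<Rightarrow> 'a \<Rightarrow> real) \<Rightarrow> (real \<Rightarrow> real) \<Rightarrow> (real \<Rightarrow> real \<Rightarrow> real) \<Rightarrow> bool" where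
  "CP_evolution M \<epsilon> X \<Lambda> v \<longleftrightarrow>
     (let x_inf = ess_norm M (X 0); v0 = (\<lambda>x. 1 / mean_residual M (X 0) x) in
        inviscid_CP_solution \<epsilon> x_inf v0 \<Lambda> v \<and>
        (\<forall>t\<ge>0. CP_corresponds M (X t) (CP_domain \<epsilon> x_inf v0 (\<lambda>s. 1 / \<Lambda> s) t) (\<lambda>x. v x t)) \<and>
        (\<forall>t>0. AE \<omega> in M. X t \<omega> \<noteq> 0))"

end

theory Submission
  imports Defs
begin

text \<open>
  The mean \<open>\<Lambda>(t) = \<langle>X\<^sub>t\<rangle>\<close> depends only on the characteristic that arrives at \<open>x = 0\<close> at time
  \<open>t\<close>. Let \<open>z(t)\<close> be its starting point, \<open>m = m\<^sub>1\<close>, and \<open>S\<^sub>n(t) = \<integral>\<^sub>0\<^sup>t m(s)\<^sup>-\<^sup>n ds\<close>. Since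
  \<open>m\<^sub>2 = m S\<^sub>1\<close> and \<open>\<sigma>\<^sup>2 = m\<^sup>2 S\<^sub>2\<close>, the model turns into the two relations
  \<open>m' = u\<close>, \<open>z + \<epsilon> u S\<^sub>2 = S\<^sub>1\<close>, where \<open>u(t) = v\<^sub>0(z(t))\<close>, and \<open>\<Lambda> = m / u\<close>. The second relation may be
  differentiated formally:

  \<open>z' + \<epsilon> S\<^sub>2 u' = (1 - \<epsilon> u / m) / m\<close>.

  Everything follows from it. First, \<open>z \<ge> 0\<close> and \<open>S\<^sub>1 \<le> m S\<^sub>2\<close> give \<open>\<epsilon> u \<le> m\<close>, so \<open>z\<close> and \<open>u\<close> are
  increasing, \<open>m\<close> is convex, and \<open>u' \<le> 1 / (\<epsilon> S\<^sub>2 m)\<close>, which is of order \<open>1 / t\<close> at most.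
  Secondly, \<open>u\<close> tends to infinity: for bounded \<open>u\<close> the function \<open>m\<close> would grow at most linearly and
  \<open>S\<^sub>1\<close> would diverge, whereas \<open>z\<close> (because \<open>\<parallel>X\<^sub>0\<parallel>\<^sub>\<infinity> < \<infinity>\<close>) and \<open>\<epsilon> u S\<^sub>2\<close> would stay
  bounded. Consequently \<open>u\<close> changes by a bounded amount between \<open>\<delta>t\<close> and \<open>t\<close>, which is negligible
  against \<open>u(t)\<close>. With convexity, \<open>(1 - \<delta>) t u(\<delta>t) \<le> m(t) \<le> 1 + t u(t)\<close>, and so \<open>\<Lambda>(t) / t \<rightarrow> 1\<close>
  (\<open>mean_over_t_tendsto\<close>). As \<open>v\<^sub>0\<close> is only monotone, this part works with increments in place of
  derivatives.

  For the second claim, \<open>z(t)\<close> tends to the right end point, where \<open>v\<^sub>0\<close> is differentiable with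
  derivative \<open>p \<ge> c > 0\<close>. Then \<open>u' = p z'\<close> exists and \<open>m u'\<close> lies between two positive constants for
  large \<open>t\<close>. The lower one, with \<open>m \<le> 2 t u\<close>, makes \<open>(u\<^sup>2)'\<close> at least of order \<open>1 / t\<close>, hence
  \<open>u\<^sup>2\<close> at least of order \<open>ln t\<close>; the upper one then bounds \<open>1 - \<Lambda>' = m u' / u\<^sup>2\<close>
  (\<open>mean_deriv_bounds\<close>).
\<close>

section \<open>Calculus on the half line\<close>

lemma indefinite_integral_half_line:
  fixes g :: "real \<Rightarrow> real"
  assumes g: "continuous_on {0..} g"
  shows "continuous_on {0..} (\<lambda>t. integral {0..t} g)"
    and "0 < t \<Longrightarrow> ((\<lambda>t. integral {0..t} g) has_real_derivative g t) (at t)"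
proof -
  have *: "((\<lambda>t. integral {0..t} g) has_real_derivative g t) (at t within {0..b})"
    if "0 \<le> t" "t < b" for t b
    using that by (intro integral_has_real_derivative continuous_on_subset[OF g]) auto
  show "((\<lambda>t. integral {0..t} g) has_real_derivative g t) (at t)" if "0 < t" for t
    using *[of t "t + 1"] that by (simp add: at_within_Icc_at)
  show "continuous_on {0..} (\<lambda>t. integral {0..t} g)"
    unfolding continuous_on_eq_continuous_within
  proof
    fix t :: real
    assume t: "t \<in> {0..}"
    have "continuous (at t within {0..t+1}) (\<lambda>t. integral {0..t} g)"
      using *[of t "t + 1"] t DERIV_continuous by fastforce
    moreover have "at t within {0..t+1} = at t within {0..}"
      by (rule at_within_nhd[of _ "{t-1<..<t+1}"]) auto
    ultimately show "continuous (at t within {0..}) (\<lambda>t. integral {0..t} g)"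
      by simp
  qed
qed

lemma nondecreasing_by_deriv:
  fixes f f' :: "real \<Rightarrow> real"
  assumes "0 \<le> s" "s \<le> t" "continuous_on {0..} f"
    and "\<And>r. s < r \<Longrightarrow> r < t \<Longrightarrow> (f has_real_derivative f' r) (at r)"
    and "\<And>r. s < r \<Longrightarrow> r < t \<Longrightarrow> 0 \<le> f' r"
  shows "f s \<le> f t"
proof (rule DERIV_nonneg_imp_increasing_open[OF \<open>s \<le> t\<close>])
  show "continuous_on {s..t} f"
    by (rule continuous_on_subset[OF assms(3)]) (use \<open>0 \<le> s\<close> in auto)
qed (use assms(4,5) in blast)

section \<open>The characteristic arriving at the origin\<close>

text \<open>
  The model restricted to \<open>x = 0\<close>: \<open>z t\<close> is the starting point of the characteristic that reaches
  the origin at time \<open>t\<close>, and \<open>m\<close> is \<open>m\<^sub>1\<close>. The equation \<open>m' = v\<^sub>0(z)\<close> encodes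
  \<open>A = v(0, t) = v\<^sub>0(z) / m\<close> together with \<open>m' = A m\<close>.
\<close>
locale origin_characteristic =
  fixes \<epsilon> x_inf :: real and v0 z m :: "real \<Rightarrow> real"
  assumes eps_pos: "0 < \<epsilon>"
    and v0_mono: "mono_on {0..<x_inf} v0"
    and v0_pos: "x \<in> {0..<x_inf} \<Longrightarrow> 0 < v0 x"
    and z_range: "0 \<le> t \<Longrightarrow> z t \<in> {0..<x_inf}"
    and m_0: "m 0 = 1"
    and m_cont: "continuous_on {0..} m"
    and m_deriv: "0 < t \<Longrightarrow> (m has_real_derivative v0 (z t)) (at t)"
    and rate_cont: "continuous_on {0..} (\<lambda>t. v0 (z t))"
    and char_eq: "0 \<le> t \<Longrightarrow> z t + \<epsilon> * integral {0..t} (\<lambda>s. 1 / (m s)\<^sup>2) * v0 (z t)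
                    = integral {0..t} (\<lambda>s. 1 / m s)"
begin

text \<open>This is both the rate \<open>m'\<close> and the initial value of \<open>v\<close> carried to the origin.\<close>
definition "u t = v0 (z t)"
definition "S1 t = integral {0..t} (\<lambda>s. 1 / m s)"
definition "S2 t = integral {0..t} (\<lambda>s. 1 / (m s)\<^sup>2)"

lemma foot_eq: "0 \<le> t \<Longrightarrow> z t + \<epsilon> * S2 t * u t = S1 t"
  using char_eq by (simp add: S1_def S2_def u_def)

lemma m_DERIV: "0 < t \<Longrightarrow> (m has_real_derivative u t) (at t)"
  using m_deriv by (simp add: u_def)

lemma u_cont: "continuous_on {0..} u"
  using rate_cont by (simp add: u_def[abs_def])

lemma zero_in: "0 \<in> {0..<x_inf}"
  using z_range[of 0] by auto

lemma v0_zero_pos: "0 < v0 0"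
  using v0_pos[OF zero_in] .

lemma u_lower: "0 \<le> t \<Longrightarrow> v0 0 \<le> u t"
  using mono_onD[OF v0_mono zero_in z_range[of t]] z_range[of t] by (simp add: u_def)

lemma u_pos: "0 \<le> t \<Longrightarrow> 0 < u t"
  using u_lower v0_zero_pos by fastforce

lemma m_lower:
  assumes "0 \<le> t"
  shows "1 + v0 0 * t \<le> m t"
proof -
  have "m 0 - v0 0 * 0 \<le> m t - v0 0 * t"
  proof (rule nondecreasing_by_deriv
      [where f = "\<lambda>r. m r - v0 0 * r" and f' = "\<lambda>r. u r - v0 0"])
    show "continuous_on {0..} (\<lambda>t. m t - v0 0 * t)"
      by (intro continuous_intros m_cont)
    show "((\<lambda>t. m t - v0 0 * t) has_real_derivative u r - v0 0) (at r)" if "0 < r" for r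
      using that by (auto intro!: derivative_eq_intros m_DERIV)
  qed (use assms u_lower in auto)
  then show ?thesis by (simp add: m_0)
qed

lemma m_pos: "0 \<le> t \<Longrightarrow> 0 < m t"
  using m_lower[of t] v0_zero_pos mult_nonneg_nonneg[of "v0 0" t] by linarith

lemma S_cont: "continuous_on {0..} S1" "continuous_on {0..} S2"
  unfolding S1_def[abs_def] S2_def[abs_def]
  by (intro indefinite_integral_half_line continuous_intros m_cont ballI;
      use m_pos in fastforce)+

lemma S_DERIV:
  assumes "0 < t"
  shows "(S1 has_real_derivative 1 / m t) (at t)" "(S2 has_real_derivative 1 / (m t)\<^sup>2) (at t)"
  unfolding S1_def[abs_def] S2_def[abs_def]
  by (intro indefinite_integral_half_line(2)[OF _ assms] continuous_intros m_cont ballI;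
      use m_pos in fastforce)+

lemma S_at_zero: "S1 0 = 0" "S2 0 = 0"
  by (simp_all add: S1_def S2_def)

text \<open>All comparisons between \<open>S1\<close>, \<open>S2\<close>, \<open>m\<close> and \<open>t\<close> are linear with coefficients that are
  constant on the time interval in question, and follow by choosing them here.\<close>
lemma linear_combination_mono:
  assumes "0 \<le> s" "s \<le> t"
    and nonneg: "\<And>r. s < r \<Longrightarrow> r < t \<Longrightarrow>
      0 \<le> a * (1 / m r) + b * (1 / (m r)\<^sup>2) + c * u r + d"
  shows "a * S1 s + b * S2 s + c * m s + d * s \<le> a * S1 t + b * S2 t + c * m t + d * t"
proof (rule nondecreasing_by_deriv[OF assms(1,2) _ _ nonneg])
  show "continuous_on {0..} (\<lambda>t. a * S1 t + b * S2 t + c * m t + d * t)"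
    by (intro continuous_intros S_cont m_cont)
  show "((\<lambda>t. a * S1 t + b * S2 t + c * m t + d * t) has_real_derivative
      a * (1 / m r) + b * (1 / (m r)\<^sup>2) + c * u r + d) (at r)" if "s < r" for r
    using assms(1) that by (auto intro!: derivative_eq_intros S_DERIV m_DERIV)
qed

lemma m_mono: "0 \<le> s \<Longrightarrow> s \<le> t \<Longrightarrow> m s \<le> m t"
  using linear_combination_mono[of s t 0 0 1 0] u_pos by (simp add: less_imp_le)

text \<open>As \<open>m\<close> increases, \<open>1 / m\<close> on \<open>[s, t]\<close> lies between \<open>m s\<close> and \<open>m t\<close> times \<open>1 / m\<^sup>2\<close>.\<close>
lemma S1_increment:
  assumes st: "0 \<le> s" "s \<le> t"
  shows "m s * (S2 t - S2 s) \<le> S1 t - S1 s" "S1 t - S1 s \<le> m t * (S2 t - S2 s)"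
    and "S1 t - S1 s \<le> (t - s) / m s"
proof -
  have m: "0 < m s" "0 < m r" "m s \<le> m r" "m r \<le> m t" if "s < r" "r < t" for r
    using that st m_pos m_mono by auto
  have "0 \<le> 1 * (1 / m r) + (- m s) * (1 / (m r)\<^sup>2) + 0 * u r + 0" if "s < r" "r < t" for r
    using m[OF that] by (simp add: field_simps power2_eq_square)
  from linear_combination_mono[OF st this] show "m s * (S2 t - S2 s) \<le> S1 t - S1 s"
    by (simp add: algebra_simps)
  have "0 \<le> (- 1) * (1 / m r) + m t * (1 / (m r)\<^sup>2) + 0 * u r + 0" if "s < r" "r < t" for r
    using m[OF that] by (simp add: field_simps power2_eq_square)
  from linear_combination_mono[OF st this] show "S1 t - S1 s \<le> m t * (S2 t - S2 s)"
    by (simp add: algebra_simps)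
  have "0 \<le> (- 1) * (1 / m r) + 0 * (1 / (m r)\<^sup>2) + 0 * u r + 1 / m s" if "s < r" "r < t" for r
    using m[OF that] by (simp add: field_simps)
  from linear_combination_mono[OF st this] show "S1 t - S1 s \<le> (t - s) / m s"
    by (simp add: diff_divide_distrib)
qed

lemma S2_mono: "0 \<le> s \<Longrightarrow> s \<le> t \<Longrightarrow> S2 s \<le> S2 t"
  using linear_combination_mono[of s t 0 1 0 0] by simp

lemma S2_pos:
  assumes "0 < t"
  shows "0 < S2 t"
proof -
  have "0 \<le> 0 * (1 / m r) + 1 * (1 / (m r)\<^sup>2) + 0 * u r + (- (1 / (m t)\<^sup>2))"
    if "0 < r" "r < t" for r
    using that m_pos[of r] m_mono[of r t] by (simp add: frac_le power_mono)
  from linear_combination_mono[OF order_refl _ this] have "t / (m t)\<^sup>2 \<le> S2 t"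
    using assms by (simp add: S_at_zero)
  moreover have "0 < t / (m t)\<^sup>2"
    using assms m_pos[of t] by simp
  ultimately show ?thesis by linarith
qed

text \<open>Because \<open>m' \<ge> v\<^sub>0(0)\<close>, the integrand \<open>1 / m\<^sup>2\<close> is at most the derivative of \<open>- 1 / (v\<^sub>0(0) m)\<close>.\<close>
lemma S2_bounded:
  assumes "0 \<le> t"
  shows "S2 t \<le> 1 / v0 0"
proof -
  have pos: "0 < m r" "v0 0 \<le> u r" if "0 < r" for r
    using that m_pos u_lower by auto
  have "- (1 / (v0 0 * m 0)) - S2 0 \<le> - (1 / (v0 0 * m t)) - S2 t"
  proof (rule nondecreasing_by_deriv
      [where f = "\<lambda>r. - (1 / (v0 0 * m r)) - S2 r"
        and f' = "\<lambda>r. u r / (v0 0 * (m r)\<^sup>2) - 1 / (m r)\<^sup>2"])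
    show "continuous_on {0..} (\<lambda>t. - (1 / (v0 0 * m t)) - S2 t)"
      using v0_zero_pos m_pos by (intro continuous_intros S_cont m_cont) fastforce
    fix r :: real
    assume r: "0 < r"
    show "((\<lambda>t. - (1 / (v0 0 * m t)) - S2 t) has_real_derivative
           u r / (v0 0 * (m r)\<^sup>2) - 1 / (m r)\<^sup>2) (at r)"
      using v0_zero_pos pos[OF r]
      by (auto intro!: derivative_eq_intros m_DERIV S_DERIV r simp: field_simps power2_eq_square)
    show "0 \<le> u r / (v0 0 * (m r)\<^sup>2) - 1 / (m r)\<^sup>2"
      using v0_zero_pos pos[OF r] by (simp add: field_simps)
  qed (use assms in auto)
  moreover have "0 < 1 / (v0 0 * m t)"
    using v0_zero_pos m_pos[OF assms] by simp
  ultimately show ?thesis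
    unfolding m_0 S_at_zero mult_1_right by linarith
qed

text \<open>In terms of the model this says that \<open>\<Lambda> \<ge> \<epsilon>\<close>, that is, the characteristic velocity
  \<open>\<epsilon> v - 1\<close> at the origin is never positive. It comes from \<open>z \<ge> 0\<close>: \<open>\<epsilon> u S2 \<le> S1 \<le> m S2\<close>.\<close>
lemma eps_u_le_m:
  assumes "0 < t"
  shows "\<epsilon> * u t \<le> m t"
proof -
  have "\<epsilon> * S2 t * u t \<le> S1 t"
    using foot_eq[of t] z_range[of t] assms by auto
  also have "\<dots> \<le> m t * S2 t"
    using S1_increment(2)[of 0 t] assms by (simp add: S_at_zero)
  finally have "S2 t * (\<epsilon> * u t) \<le> S2 t * m t"
    by (simp add: mult_ac)
  then show ?thesis
    using S2_pos[OF assms] by simp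
qed

text \<open>If \<open>z t < z s\<close>, then \<open>u t \<le> u s\<close>. Freezing \<open>z s\<close> and \<open>u s\<close> in the equation and moving the
  time from \<open>s\<close> to \<open>t\<close> adds \<open>\<epsilon> u(s) (S2(t) - S2(s))\<close> on the left, which is at most the increase
  of \<open>S1\<close> because \<open>\<epsilon> u s \<le> m s\<close>. So \<open>z s + \<epsilon> u(s) S2(t) \<le> S1 t = z t + \<epsilon> u(t) S2(t)\<close>,
  although \<open>z t < z s\<close> and \<open>u t \<le> u s\<close>.\<close>
lemma z_mono:
  assumes "0 < s" "s \<le> t"
  shows "z s \<le> z t"
proof (rule ccontr)
  assume "\<not> z s \<le> z t"
  then have z: "z t < z s" by simp
  then have u: "u t \<le> u s"
    unfolding u_def using assms by (intro mono_onD[OF v0_mono] z_range) auto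
  have "z s + \<epsilon> * S2 t * u s = S1 s + (\<epsilon> * u s) * (S2 t - S2 s)"
    using foot_eq[of s] assms by (simp add: algebra_simps)
  also have "\<dots> \<le> S1 s + m s * (S2 t - S2 s)"
    using eps_u_le_m[of s] S2_mono[of s t] assms by (intro add_left_mono mult_right_mono) auto
  also have "\<dots> \<le> S1 t"
    using S1_increment(1)[of s t] assms by simp
  also have "\<dots> = z t + \<epsilon> * S2 t * u t"
    using foot_eq[of t] assms by simp
  also have "\<dots> \<le> z t + \<epsilon> * S2 t * u s"
    using u S2_pos[of t] eps_pos assms by (intro add_left_mono mult_left_mono) auto
  finally show False using z by simp
qed

lemma u_mono: "0 < s \<Longrightarrow> s \<le> t \<Longrightarrow> u s \<le> u t"
  unfolding u_def using z_mono by (intro mono_onD[OF v0_mono] z_range) auto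

text \<open>An integrated form of \<open>u' \<le> 1 / (\<epsilon> S2 m)\<close> that does not differentiate \<open>v\<^sub>0\<close>: in the
  difference of the equation at \<open>s\<close> and \<open>t\<close> the other two terms are non-negative.\<close>
lemma u_increment:
  assumes "0 < s" "s \<le> t"
  shows "u t - u s \<le> (t - s) / (\<epsilon> * S2 s * m s)"
proof -
  have "(z t - z s) + \<epsilon> * S2 s * (u t - u s) + \<epsilon> * u t * (S2 t - S2 s) = S1 t - S1 s"
    using foot_eq[of s] foot_eq[of t] assms by (simp add: algebra_simps)
  moreover have "0 \<le> \<epsilon> * u t * (S2 t - S2 s)"
    using eps_pos u_pos[of t] S2_mono[of s t] assms by simp
  ultimately have "\<epsilon> * S2 s * (u t - u s) \<le> (t - s) / m s"
    using z_mono[OF assms] S1_increment(3)[of s t] assms by linarith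
  then show ?thesis
    using eps_pos S2_pos[of s] m_pos[of s] assms by (simp add: field_simps)
qed

text \<open>If \<open>u \<le> K\<close>, then \<open>S1' = 1 / m \<ge> (ln m)' / K\<close>, so \<open>S1\<close> grows at least like \<open>ln m\<close>, while
  \<open>z + \<epsilon> u S2\<close> stays bounded.\<close>
lemma u_unbounded: "\<exists>t>0. K < u t"
proof (rule ccontr)
  assume "\<not> ?thesis"
  then have K: "u t \<le> K" if "0 < t" for t
    using that by force
  have Kpos: "0 < K"
    using K[of 1] u_pos[of 1] by simp
  have ln_le: "ln (m t) \<le> K * S1 t" if t: "0 \<le> t" for t
  proof -
    have "K * S1 0 - ln (m 0) \<le> K * S1 t - ln (m t)"
    proof (rule nondecreasing_by_deriv
        [where f = "\<lambda>r. K * S1 r - ln (m r)" and f' = "\<lambda>r. K * (1 / m r) - u r / m r"])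
      show "continuous_on {0..} (\<lambda>t. K * S1 t - ln (m t))"
        using m_pos by (intro continuous_intros S_cont m_cont) fastforce
      fix r :: real
      assume r: "0 < r"
      show "((\<lambda>t. K * S1 t - ln (m t)) has_real_derivative K * (1 / m r) - u r / m r) (at r)"
        using m_pos[of r] r by (auto intro!: derivative_eq_intros m_DERIV S_DERIV r)
      show "0 \<le> K * (1 / m r) - u r / m r"
        using m_pos[of r] K[OF r] r by (simp add: field_simps)
    qed (use t in auto)
    then show ?thesis by (simp add: m_0 S_at_zero)
  qed
  define B where "B = K * (x_inf + \<epsilon> * K / v0 0)"
  have "S1 t \<le> x_inf + \<epsilon> * K / v0 0" if "0 < t" for t
  proof -
    have "\<epsilon> * S2 t * u t \<le> \<epsilon> * (1 / v0 0) * K"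
      using S2_bounded[of t] K[OF that] S2_pos[OF that] u_pos[of t] eps_pos that v0_zero_pos
      by (intro mult_mono) auto
    then show ?thesis
      using foot_eq[of t] z_range[of t] that by auto
  qed
  then have "ln (m t) \<le> B" if "0 < t" for t
    using ln_le[of t] Kpos that unfolding B_def by (meson less_imp_le mult_left_mono order_trans)
  then have *: "1 + v0 0 * t \<le> exp B" if "0 < t" for t
    using m_lower[of t] m_pos[of t] that by (smt (verit) exp_le_cancel_iff exp_ln)
  show False
    using *[of "exp B / v0 0"] v0_zero_pos by simp
qed

lemma u_at_top: "filterlim u at_top at_top"
  unfolding filterlim_at_top eventually_at_top_linorder
proof
  fix K
  obtain t where "0 < t" "K < u t"
    using u_unbounded by blast
  then show "\<exists>N. \<forall>n\<ge>N. K \<le> u n"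
    using u_mono by (meson less_imp_le order_trans)
qed

section \<open>Linear growth of the mean\<close>

text \<open>This is \<open>\<Lambda> = 1 / v(0, t)\<close>, since \<open>v(0, t) = v\<^sub>0(z(t)) / m(t)\<close>.\<close>
definition "mean t = m t / u t"

lemma m_convex:
  assumes "0 < s" "s \<le> t"
  shows "m s + u s * (t - s) \<le> m t"
proof -
  have "0 \<le> 0 * (1 / m r) + 0 * (1 / (m r)\<^sup>2) + 1 * u r + (- u s)" if "s < r" "r < t" for r
    using that u_mono[of s r] assms by simp
  from linear_combination_mono[OF _ _ this] show ?thesis
    using assms by (simp add: algebra_simps)
qed

lemma m_upper:
  assumes "0 < t"
  shows "m t \<le> 1 + u t * t"
proof -
  have "0 \<le> 0 * (1 / m r) + 0 * (1 / (m r)\<^sup>2) + (- 1) * u r + u t" if "0 < r" "r < t" for r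
    using that u_mono[of r t] assms by simp
  from linear_combination_mono[where s = 0 and t = t, OF order_refl _ this] show ?thesis
    using assms by (simp add: m_0)
qed

text \<open>For the lower bound fix \<open>d \<in> (0, 1)\<close> and take \<open>s = d t\<close>. From \<open>s\<close> to \<open>t\<close>, \<open>u\<close> grows by at most
  a constant \<open>k\<close> that does not depend on \<open>t\<close>, because \<open>u' \<le> 1 / (\<epsilon> S2 m)\<close> and \<open>m s\<close> is at least
  proportional to \<open>t\<close>. Convexity gives \<open>m t \<ge> (t - s) u s \<ge> (1 - d) t (u t - k)\<close>, and \<open>k\<close> is
  negligible against \<open>u t\<close>.\<close>
lemma mean_over_t_tendsto: "((\<lambda>t. mean t / t) \<longlongrightarrow> 1) at_top"
proof (rule order_tendstoI)
  have inv_u: "((\<lambda>t. k / u t) \<longlongrightarrow> 0) at_top" for k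
    using u_at_top by (intro tendsto_divide_0[OF tendsto_const] filterlim_at_top_imp_at_infinity)
  fix a :: real
  assume "a < 1"
  \<comment> \<open>The case \<open>a < 0\<close> is separate only to keep \<open>d\<close> below 1.\<close>
  define d where "d = (if a < 0 then 1/2 else (1 - a) / 2)"
  have d: "0 < d" "d < 1" "a < 1 - d"
    using \<open>a < 1\<close> by (auto simp: d_def field_simps)
  define k where "k = 1 / (\<epsilon> * S2 1 * v0 0 * d)"
  have "((\<lambda>t. (1 - d) * (1 - k / u t)) \<longlongrightarrow> (1 - d) * (1 - 0)) at_top"
    by (intro tendsto_intros inv_u)
  then have "\<forall>\<^sub>F t in at_top. a < (1 - d) * (1 - k / u t)"
    using d by (simp add: order_tendstoD)
  moreover have "\<forall>\<^sub>F t in at_top. (1 - d) * (1 - k / u t) \<le> mean t / t"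
    \<comment> \<open>From \<open>t = 1 / d\<close> on, \<open>s = d t \<ge> 1\<close>, so that \<open>S2 s\<close> is bounded below by \<open>S2 1\<close>.\<close>
    using eventually_ge_at_top[of "1 / d"]
  proof eventually_elim
    case (elim t)
    define s where "s = d * t"
    have t: "1 \<le> s" "s \<le> t" "0 < s" "0 < t"
    proof -
      show "0 < t"
        using elim d by (smt (verit) zero_less_divide_1_iff)
      then show "1 \<le> s" "s \<le> t" "0 < s"
        using elim d by (auto simp: s_def field_simps)
    qed
    have "(t - s) / (\<epsilon> * S2 s * m s) \<le> t / (\<epsilon> * S2 1 * (v0 0 * s))"
    proof (rule frac_le)
      have "S2 1 \<le> S2 s" "v0 0 * s \<le> m s"
        using S2_mono[of 1 s] m_lower[of s] t by auto
      then show "\<epsilon> * S2 1 * (v0 0 * s) \<le> \<epsilon> * S2 s * m s"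
        using eps_pos S2_pos[of 1] v0_zero_pos t by (intro mult_mono) auto
      show "0 < \<epsilon> * S2 1 * (v0 0 * s)"
        using eps_pos S2_pos[of 1] v0_zero_pos t by simp
    qed (use t in auto)
    also have "\<dots> = k"
      using t d by (simp add: k_def s_def)
    finally have "u t - k \<le> u s"
      using u_increment[of s t] t by simp
    then have "(u t - k) * (t - s) \<le> u s * (t - s)"
      using t by (intro mult_right_mono) auto
    also have "\<dots> \<le> m t"
      using m_convex[of s t] m_pos[of s] t by simp
    finally have "(1 - d) * t * (u t - k) \<le> m t"
      by (simp add: s_def algebra_simps)
    then have "(1 - d) * t * (u t - k) / (u t * t) \<le> m t / (u t * t)"
      using u_pos[of t] t by (intro divide_right_mono) auto
    moreover have "(1 - d) * t * (u t - k) / (u t * t) = (1 - d) * (1 - k / u t)"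
      using u_pos[of t] t by (simp add: field_simps)
    ultimately show ?case
      by (simp add: mean_def)
  qed
  ultimately show "\<forall>\<^sub>F t in at_top. a < mean t / t"
    by eventually_elim simp
next
  fix a :: real
  assume "1 < a"
  have "((\<lambda>t. 1 + 1 / u t) \<longlongrightarrow> 1 + 0) at_top"
    using u_at_top
    by (intro tendsto_intros tendsto_divide_0[OF tendsto_const] filterlim_at_top_imp_at_infinity)
  then have "\<forall>\<^sub>F t in at_top. 1 + 1 / u t < a"
    using \<open>1 < a\<close> by (simp add: order_tendstoD)
  then show "\<forall>\<^sub>F t in at_top. mean t / t < a"
    using eventually_ge_at_top[of 1]
  proof eventually_elim
    case (elim t)
    have "m t \<le> t + u t * t"
      using m_upper[of t] elim by simp
    then have "mean t / t \<le> 1 + 1 / u t"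
      using u_pos[of t] elim by (simp add: mean_def field_simps)
    then show ?case using elim by simp
  qed
qed

section \<open>The rate of convergence\<close>

text \<open>\<open>v\<^sub>0\<close> is bounded on \<open>[0, b]\<close> by monotonicity, but \<open>u = v\<^sub>0 \<circ> z\<close> tends to infinity.\<close>
lemma z_eventually_gt:
  assumes "b < x_inf"
  shows "\<forall>\<^sub>F t in at_top. b < z t"
proof -
  define b' where "b' = max b 0"
  have b': "b' \<in> {0..<x_inf}"
    using assms zero_in by (auto simp: b'_def)
  have "\<forall>\<^sub>F t in at_top. v0 b' < u t"
    using u_at_top by (simp add: filterlim_at_top_dense)
  then show ?thesis
    using eventually_ge_at_top[of 0]
  proof eventually_elim
    case (elim t)
    then have "b' < z t"
      using mono_onD[OF v0_mono z_range[of t] b'] by (force simp: u_def)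
    then show ?case by (simp add: b'_def)
  qed
qed

lemma z_cont: "continuous_on {0..} z"
proof -
  have "continuous_on {0..} (\<lambda>t. S1 t - \<epsilon> * S2 t * u t)"
    by (intro continuous_intros S_cont u_cont)
  then show ?thesis
    by (rule continuous_on_eq) (use foot_eq in \<open>force simp: algebra_simps\<close>)
qed

text \<open>The implicit function theorem for \<open>z + \<epsilon> S2(t) v\<^sub>0(z) = S1(t)\<close>, with \<open>v\<^sub>0\<close> differentiable at
  the single point \<open>z t\<close> only. Caratheodory's slope function \<open>g\<close> for \<open>v\<^sub>0\<close> at \<open>z t\<close> writes the
  difference of the equation at \<open>s\<close> and \<open>t\<close> as \<open>(z s - z t) D(s) = N(s) - N(t)\<close>, in which \<open>N\<close> is
  differentiable and \<open>D\<close> is continuous at \<open>t\<close>.\<close>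
lemma z_DERIV:
  assumes t: "0 < t" and p: "(v0 has_real_derivative p) (at (z t))" "0 < p"
  shows "(z has_real_derivative (1 - \<epsilon> * u t / m t) / m t / (1 + \<epsilon> * S2 t * p)) (at t)"
proof -
  obtain g where g: "\<And>y. v0 y - v0 (z t) = g y * (y - z t)" "isCont g (z t)" "g (z t) = p"
    using p(1) unfolding CARAT_DERIV by blast
  define D where "D s = 1 + \<epsilon> * S2 s * g (z s)" for s
  define N where "N s = S1 s - \<epsilon> * u t * S2 s" for s
  have zc: "isCont z t"
    using z_cont t by (simp add: continuous_on_interior)
  have Sc: "isCont S2 t"
    using S_cont t by (simp add: continuous_on_interior)
  have Dlim: "(D \<longlongrightarrow> 1 + \<epsilon> * S2 t * p) (at t)"
    unfolding D_def using g(2,3) zc Sc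
    by (intro tendsto_intros) (auto simp: isCont_def intro: isCont_tendsto_compose[of "z t" g])
  have Dpos: "0 < 1 + \<epsilon> * S2 t * p"
    using eps_pos S2_pos[OF t] p(2) by (simp add: add_pos_pos)
  have "(N has_real_derivative 1 / m t - \<epsilon> * u t * (1 / (m t)\<^sup>2)) (at t)"
    unfolding N_def by (auto intro!: derivative_eq_intros S_DERIV t)
  then have Nlim: "((\<lambda>s. (N s - N t) / (s - t)) \<longlongrightarrow> 1 / m t - \<epsilon> * u t * (1 / (m t)\<^sup>2)) (at t)"
    by (simp add: has_field_derivative_iff)
  have "((\<lambda>s. (N s - N t) / (s - t) / D s) \<longlongrightarrow>
      (1 / m t - \<epsilon> * u t * (1 / (m t)\<^sup>2)) / (1 + \<epsilon> * S2 t * p)) (at t)"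
    using Dpos by (intro tendsto_divide Nlim Dlim) auto
  moreover have "1 / m t - \<epsilon> * u t * (1 / (m t)\<^sup>2) = (1 - \<epsilon> * u t / m t) / m t"
    using m_pos[of t] t by (simp add: field_simps power2_eq_square)
  moreover have "\<forall>\<^sub>F s in at t. (N s - N t) / (s - t) / D s = (z s - z t) / (s - t)"
  proof -
    have "\<forall>\<^sub>F s in at t. 0 < D s"
      using order_tendstoD(1)[OF Dlim Dpos] .
    moreover have "\<forall>\<^sub>F s in at t. 0 < s"
      using order_tendstoD(1)[OF tendsto_ident_at t] .
    ultimately show ?thesis
    proof eventually_elim
      case (elim s)
      have "(z s - z t) + \<epsilon> * S2 s * (u s - u t) = N s - N t"
        using foot_eq[of s] foot_eq[of t] elim t by (simp add: N_def algebra_simps)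
      then have "(z s - z t) * D s = N s - N t"
        using g(1)[of "z s"] by (simp add: D_def u_def algebra_simps)
      then show ?case
        using elim by (metis less_irrefl nonzero_mult_div_cancel_right times_divide_eq_left divide_divide_eq_left mult.commute)
    qed
  qed
  ultimately show ?thesis
    unfolding has_field_derivative_iff by (auto elim: Lim_transform_eventually)
qed

lemma u_DERIV:
  assumes t: "0 < t" and p: "(v0 has_real_derivative p) (at (z t))" "0 < p"
  shows "(u has_real_derivative (1 - \<epsilon> * u t / m t) * (p / (1 + \<epsilon> * S2 t * p)) / m t) (at t)"
proof -
  have "((v0 \<circ> z) has_real_derivative p * ((1 - \<epsilon> * u t / m t) / m t / (1 + \<epsilon> * S2 t * p))) (at t)"
    by (rule DERIV_chain[OF p(1) z_DERIV[OF assms]])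
  then show ?thesis
    by (simp add: u_def[abs_def] comp_def mult_ac)
qed

lemma mean_at_top: "filterlim mean at_top at_top"
proof -
  have "filterlim (\<lambda>t. (mean t / t) * t) at_top at_top"
    by (rule filterlim_tendsto_pos_mult_at_top[OF mean_over_t_tendsto _ filterlim_ident]) simp
  moreover have "\<forall>\<^sub>F t in at_top. (mean t / t) * t = mean t"
    using eventually_gt_at_top[of 0] by eventually_elim simp
  ultimately show ?thesis
    by (simp add: filterlim_cong)
qed

text \<open>With \<open>w = u'\<close> one has \<open>mean' = 1 - m w / u\<^sup>2\<close>. The factor \<open>p / (1 + \<epsilon> S2 p)\<close> in \<open>m w\<close> increases
  with \<open>p\<close> and decreases with \<open>S2\<close>, so it lies between its value at \<open>p = c\<close>, \<open>S2 = 1 / v\<^sub>0(0)\<close> and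
  its limit \<open>1 / (\<epsilon> S2 t)\<close> for \<open>p \<rightarrow> \<infinity>\<close>, which is at most \<open>1 / (\<epsilon> S2 1)\<close> for \<open>t \<ge> 1\<close>. The other factor \<open>1 - \<epsilon> u / m = 1 - \<epsilon> / mean\<close> lies in \<open>[1/2, 1]\<close> once
  \<open>mean \<ge> 2 \<epsilon>\<close>.\<close>
lemma mean_deriv_bounds:
  assumes b: "b < x_inf" and c: "0 < c"
    and v0': "\<And>x. b < x \<Longrightarrow> x < x_inf \<Longrightarrow> \<exists>p\<ge>c. (v0 has_real_derivative p) (at x)"
  shows "\<exists>C T. 0 < C \<and> 1 < T \<and>
    (\<forall>t\<ge>T. \<exists>D. (mean has_real_derivative D) (at t) \<and> 1 - C / ln t \<le> D \<and> D \<le> 1)"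
proof -
  define k where "k = (1/2) * (c / (1 + \<epsilon> * (1 / v0 0) * c))"
  define K where "K = 1 / (\<epsilon> * S2 1)"
  have k: "0 < k"
    using c eps_pos v0_zero_pos by (simp add: k_def add_pos_pos)
  have K: "0 < K"
    using eps_pos S2_pos[of 1] by (simp add: K_def)
  have "\<forall>\<^sub>F t in at_top. mean t / t < 2"
    by (rule order_tendstoD(2)[OF mean_over_t_tendsto]) simp
  moreover have "\<forall>\<^sub>F t in at_top. 2 * \<epsilon> \<le> mean t"
    using mean_at_top by (simp add: filterlim_at_top)
  ultimately have "\<forall>\<^sub>F t in at_top. b < z t \<and> 2 * \<epsilon> \<le> mean t \<and> mean t / t < 2"
    using z_eventually_gt[OF b] by eventually_elim simp
  then obtain T0 where T0: "\<And>t. T0 \<le> t \<Longrightarrow> b < z t \<and> 2 * \<epsilon> \<le> mean t \<and> mean t / t < 2"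
    by (auto simp: eventually_at_top_linorder)
  define T1 where "T1 = max T0 2"
  have T1: "1 < T1" "T0 \<le> T1" by (auto simp: T1_def)
  have ex: "\<exists>w. (u has_real_derivative w) (at t) \<and> k \<le> m t * w \<and> m t * w \<le> K"
    if t: "T1 \<le> t" for t
  proof -
    have t0: "1 < t" "0 < m t" "0 < u t"
      using T1 t m_pos u_pos by auto
    obtain p where p: "c \<le> p" "(v0 has_real_derivative p) (at (z t))"
      using v0'[of "z t"] T0[of t] T1 t z_range[of t] by auto
    define q where "q = 1 - \<epsilon> * u t / m t"
    define y where "y = p / (1 + \<epsilon> * S2 t * p)"
    have "2 * (\<epsilon> * u t) \<le> m t"
      using T0[of t] T1 t t0 by (simp add: mean_def field_simps)
    then have q: "1/2 \<le> q" "q \<le> 1"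
      using t0 eps_pos by (auto simp: q_def field_simps)
    have S: "S2 1 \<le> S2 t" "S2 t \<le> 1 / v0 0" "0 < S2 1" "0 < S2 t"
      using S2_mono[of 1 t] S2_bounded[of t] S2_pos t0 by auto
    have den: "0 < 1 + \<epsilon> * S2 t * p" "0 < 1 + \<epsilon> * (1 / v0 0) * c"
      "0 < 1 + \<epsilon> * S2 t * c"
      using eps_pos S p c v0_zero_pos by (auto intro!: add_pos_pos)
    have "c / (1 + \<epsilon> * (1 / v0 0) * c) \<le> c / (1 + \<epsilon> * S2 t * c)"
      using eps_pos S c v0_zero_pos
      by (intro divide_left_mono add_left_mono mult_right_mono mult_left_mono mult_pos_pos add_pos_pos) auto
    also have "\<dots> \<le> y"
      using eps_pos S p(1) c den unfolding y_def
      by (subst frac_le_eq) (auto intro!: divide_nonpos_pos mult_pos_pos add_pos_pos simp: algebra_simps)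
    finally have y1: "c / (1 + \<epsilon> * (1 / v0 0) * c) \<le> y" .
    have "y \<le> 1 / (\<epsilon> * S2 t)"
      using den eps_pos S p c by (simp add: y_def field_simps)
    also have "\<dots> \<le> K"
      unfolding K_def using eps_pos S by (intro divide_left_mono mult_left_mono) auto
    finally have y2: "y \<le> K" .
    have y0: "0 \<le> y"
      using den p c by (simp add: y_def)
    have w: "(u has_real_derivative q * y / m t) (at t)"
      unfolding q_def y_def using u_DERIV[of t p] p c t0 by simp
    have "k \<le> q * y"
      unfolding k_def using q y1 c den y0 by (intro mult_mono) auto
    moreover have "q * y \<le> 1 * K"
      using q y2 K y0 by (intro mult_mono) auto
    ultimately show ?thesis
      using w t0 by (intro exI[of _ "q * y / m t"]) simp
  qed
  define w where "w t = (SOME w. (u has_real_derivative w) (at t) \<and> k \<le> m t * w \<and> m t * w \<le> K)" for t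
  have w: "(u has_real_derivative w t) (at t)" "k \<le> m t * w t" "m t * w t \<le> K"
    if "T1 \<le> t" for t
    using someI_ex[OF ex[OF that]] unfolding w_def by auto
  \<comment> \<open>\<open>(u\<^sup>2)' = 2 u w \<ge> 2 u k / m \<ge> k / t\<close>, by \<open>m \<le> 2 t u\<close>.\<close>
  have usq: "k * (ln t - ln T1) \<le> (u t)\<^sup>2" if t: "T1 \<le> t" for t
  proof -
    have "(u T1)\<^sup>2 - k * ln T1 \<le> (u t)\<^sup>2 - k * ln t"
    proof (rule DERIV_nonneg_imp_nondecreasing[OF t])
      fix r
      assume r: "T1 \<le> r" "r \<le> t"
      have r0: "1 < r" "0 < m r" "0 < u r"
        using T1 r m_pos u_pos by auto
      have "m r \<le> 2 * r * u r"
        using T0[of r] r T1 r0 by (simp add: mean_def field_simps)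
      then have "k * m r \<le> k * (2 * r * u r)"
        using k by (intro mult_left_mono) auto
      also have "\<dots> \<le> (m r * w r) * (2 * r * u r)"
        using w(2)[OF r(1)] r0 by (intro mult_right_mono) auto
      finally have "m r * k \<le> m r * (w r * (2 * r * u r))"
        by (simp add: mult_ac)
      then have "k \<le> w r * (2 * r * u r)"
        using r0 by simp
      then have "0 \<le> 2 * u r * w r - k / r"
        using r0 by (simp add: field_simps)
      moreover have "((\<lambda>t. (u t)\<^sup>2 - k * ln t) has_real_derivative 2 * u r * w r - k / r) (at r)"
        using r0 by (auto intro!: derivative_eq_intros w(1) r)
      ultimately show "\<exists>y. ((\<lambda>t. (u t)\<^sup>2 - k * ln t) has_real_derivative y) (at r) \<and> 0 \<le> y"
        by blast
    qed
    then show ?thesis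
      using zero_le_power2[of "u T1"] unfolding right_diff_distrib by linarith
  qed
  \<comment> \<open>For \<open>t \<ge> T1\<^sup>2\<close> the loss \<open>ln T1\<close> is at most half of \<open>ln t\<close>.\<close>
  have "\<exists>D. (mean has_real_derivative D) (at t) \<and> 1 - (2 * K / k) / ln t \<le> D \<and> D \<le> 1"
    if t: "T1\<^sup>2 \<le> t" for t
  proof -
    have "T1 \<le> T1\<^sup>2"
      using T1 by (simp add: power2_eq_square)
    then have tT: "T1 \<le> t" using t by simp
    then have t0: "1 < t" "0 < m t" "0 < u t"
      using T1 m_pos u_pos by auto
    have "2 * ln T1 = ln (T1\<^sup>2)"
      using T1 by (simp add: ln_realpow)
    also have "\<dots> \<le> ln t"
      using t T1 t0 by (subst ln_le_cancel_iff) auto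
    finally have "k * (ln t / 2) \<le> k * (ln t - ln T1)"
      using k by (intro mult_left_mono) auto
    then have u2: "k * ln t / 2 \<le> (u t)\<^sup>2"
      using usq[OF tT] by simp
    have lnt: "0 < ln t" using t0 by simp
    have "m t * w t / (u t)\<^sup>2 \<le> K / (k * ln t / 2)"
      using w(3)[OF tT] u2 K k lnt by (intro frac_le) auto
    also have "\<dots> = (2 * K / k) / ln t"
      by (simp add: field_simps)
    finally have up: "m t * w t / (u t)\<^sup>2 \<le> (2 * K / k) / ln t" .
    have lo: "0 \<le> m t * w t / (u t)\<^sup>2"
      using w(2)[OF tT] k by simp
    have "(mean has_real_derivative 1 - m t * w t / (u t)\<^sup>2) (at t)"
      unfolding mean_def[abs_def] using t0
      by (auto intro!: derivative_eq_intros m_DERIV w(1)[OF tT] simp: field_simps power2_eq_square)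
    then show ?thesis
      using up lo by (intro exI[of _ "1 - m t * w t / (u t)\<^sup>2"]) auto
  qed
  then show ?thesis
    using K k T1 by (intro exI[of _ "2 * K / k"] exI[of _ "T1\<^sup>2"]) (auto simp: one_less_power)
qed

end

section \<open>The mean residual life\<close>

lemma mean_residual_pos:
  assumes "prob_space M" and X: "X \<in> borel_measurable M" "AE \<omega> in M. 0 \<le> X \<omega>"
    and ess: "ess_norm M X = ereal b" and x: "0 \<le> x" "x < b"
  shows "0 < mean_residual M X x"
proof -
  interpret prob_space M by fact
  define S where "S = {\<omega> \<in> space M. X \<omega> > x}"
  note X(1)[measurable]
  have S[measurable]: "S \<in> sets M"
    unfolding S_def by measurable
  have pos: "emeasure M S \<noteq> 0"
  proof
    assume "emeasure M S = 0"
    then have "AE \<omega> in M. \<omega> \<notin> S"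
      using S by (simp add: AE_iff_measurable[OF S] S_def)
    then have "AE \<omega> in M. ereal \<bar>X \<omega>\<bar> \<le> ereal x"
      using X(2) AE_space by eventually_elim (auto simp: S_def)
    then have "ess_norm M X \<le> ereal x"
      unfolding ess_norm_def by (intro esssup_I) auto
    then show False
      using x ess by simp
  qed
  interpret U: prob_space "uniform_measure M S"
    using pos by (intro prob_space_uniform_measure) auto
  have "AE \<omega> in M. ereal \<bar>X \<omega>\<bar> \<le> ereal b"
    using esssup_AE[of "\<lambda>\<omega>. ereal \<bar>X \<omega>\<bar>" M] ess by (simp add: ess_norm_def)
  then have bound: "AE \<omega> in uniform_measure M S. norm (X \<omega> - x) \<le> b + x"
    using x by (intro AE_uniform_measureI S) (auto elim: eventually_mono)
  have "integrable (uniform_measure M S) (\<lambda>\<omega>. X \<omega> - x)"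
    by (rule U.integrable_const_bound[OF bound]) measurable
  moreover have "AE \<omega> in uniform_measure M S. 0 < X \<omega> - x"
    by (intro AE_uniform_measureI S) (simp add: S_def)
  ultimately have "(\<integral>\<omega>. 0 \<partial>uniform_measure M S) < (\<integral>\<omega>. X \<omega> - x \<partial>uniform_measure M S)"
    by (intro U.integral_less_AE_space) (auto simp: pos)
  then show ?thesis
    by (simp add: mean_residual_def S_def)
qed

text \<open>Conditioning on an event of probability one does not change the measure.\<close>
lemma mean_residual_zero_eq_expectation:
  assumes "prob_space M" and [measurable]: "X \<in> borel_measurable M" and "AE \<omega> in M. 0 < X \<omega>"
  shows "mean_residual M X 0 = prob_space.expectation M X"
proof -
  interpret prob_space M by fact
  define S where "S = {\<omega> \<in> space M. X \<omega> > 0}"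
  have S[measurable]: "S \<in> sets M"
    unfolding S_def by measurable
  have AE_S: "AE \<omega> in M. \<omega> \<in> S"
    using assms(3) AE_space by eventually_elim (simp add: S_def)
  then have "emeasure M S = 1"
    using S by (simp add: emeasure_eq_1_AE)
  then have "uniform_measure M S = density M (\<lambda>_. 1)"
    unfolding uniform_measure_def using AE_S by (intro density_cong) auto
  then show ?thesis
    by (simp add: mean_residual_def S_def density_1)
qed

section \<open>From the CP model to the characteristic at the origin\<close>

lemma exp_integral_eq_m1_ratio:
  assumes A: "continuous_on {0..} A" and st: "0 \<le> s" "s \<le> t"
  shows "exp (integral {s..t} A) = m1 A t / m1 A s"
proof -
  have "A integrable_on {0..t}"
    by (intro integrable_continuous_real continuous_on_subset[OF A]) auto
  from Henstock_Kurzweil_Integration.integral_combine[OF st this]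
  have "integral {s..t} A = integral {0..t} A - integral {0..s} A"
    by simp
  then show ?thesis
    by (simp add: m1_def exp_diff)
qed

lemma m2_eq:
  assumes A: "continuous_on {0..} A"
  shows "m2 A t = m1 A t * integral {0..t} (\<lambda>s. 1 / m1 A s)"
proof -
  have "m2 A t = integral {0..t} (\<lambda>s. m1 A t * (1 / m1 A s))"
    unfolding m2_def
    by (rule integral_cong) (simp add: exp_integral_eq_m1_ratio[OF A])
  then show ?thesis by (simp only: integral_mult_right)
qed

lemma sigma_sq_eq:
  assumes A: "continuous_on {0..} A"
  shows "sigma_sq A t = (m1 A t)\<^sup>2 * integral {0..t} (\<lambda>s. 1 / (m1 A s)\<^sup>2)"
proof -
  have "sigma_sq A t = integral {0..t} (\<lambda>s. (m1 A t)\<^sup>2 * (1 / (m1 A s)\<^sup>2))"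
    unfolding sigma_sq_def
    by (rule integral_cong)
       (simp add: exp_double exp_integral_eq_m1_ratio[OF A] power_divide)
  then show ?thesis by (simp only: integral_mult_right)
qed

lemma inviscid_CP_origin_characteristic:
  assumes sol: "inviscid_CP_solution \<epsilon> (ereal x_inf) v0 \<Lambda> v" and eps: "0 < \<epsilon>"
    and mono: "mono_on {0..<x_inf} v0" and pos: "\<And>x. x \<in> {0..<x_inf} \<Longrightarrow> 0 < v0 x"
  obtains z where "origin_characteristic \<epsilon> x_inf v0 z (m1 (\<lambda>s. 1 / \<Lambda> s))"
    and "\<And>t. 0 \<le> t \<Longrightarrow> \<Lambda> t = m1 (\<lambda>s. 1 / \<Lambda> s) t / v0 (z t)"
proof -
  define A where "A = (\<lambda>s. 1 / \<Lambda> s)"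
  define z where "z t = (THE z. CP_char \<epsilon> (ereal x_inf) v0 A 0 t z)" for t
  have \<Lambda>: "continuous_on {0..} \<Lambda>" "\<And>t. 0 \<le> t \<Longrightarrow> 0 < \<Lambda> t"
    and dom: "\<And>t. 0 \<le> t \<Longrightarrow> 0 \<in> CP_domain \<epsilon> (ereal x_inf) v0 A t"
    and v: "\<And>t x. 0 \<le> t \<Longrightarrow> x \<in> CP_domain \<epsilon> (ereal x_inf) v0 A t \<Longrightarrow>
      v x t = v0 (THE z. CP_char \<epsilon> (ereal x_inf) v0 A x t z) / m1 A t"
    and v_origin: "\<And>t. 0 \<le> t \<Longrightarrow> v 0 t = 1 / \<Lambda> t"
    using sol unfolding inviscid_CP_solution_def Let_def A_def[symmetric] by auto
  have A: "continuous_on {0..} A"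
    unfolding A_def using \<Lambda> by (intro continuous_intros) fastforce+
  have m1_pos: "0 < m1 A t" for t
    by (simp add: m1_def)
  have char: "CP_char \<epsilon> (ereal x_inf) v0 A 0 t (z t)" if "0 \<le> t" for t
    using dom[OF that] unfolding z_def CP_domain_def by (auto intro: theI')
  have z: "z t \<in> {0..<x_inf}" if "0 \<le> t" for t
    using char[OF that] by (simp add: CP_char_def)
  have rate: "v0 (z t) = A t * m1 A t" if "0 \<le> t" for t
  proof -
    have "v0 (z t) / m1 A t = A t"
      using v[OF that dom[OF that]] v_origin[OF that] by (simp add: z_def A_def)
    then show ?thesis
      using m1_pos[of t] by (simp add: field_simps)
  qed
  have m1_cont: "continuous_on {0..} (m1 A)"
    unfolding m1_def[abs_def] by (intro continuous_intros indefinite_integral_half_line A)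
  have "origin_characteristic \<epsilon> x_inf v0 z (m1 A)"
  proof
    show "(m1 A has_real_derivative v0 (z t)) (at t)" if "0 < t" for t
      unfolding rate[OF less_imp_le[OF that]] unfolding m1_def[abs_def]
      by (auto intro!: derivative_eq_intros indefinite_integral_half_line(2)[OF A that])
    have "continuous_on {0..} (\<lambda>t. A t * m1 A t)"
      by (intro continuous_intros A m1_cont)
    then show "continuous_on {0..} (\<lambda>t. v0 (z t))"
      by (rule continuous_on_eq) (simp add: rate)
    show "z t + \<epsilon> * integral {0..t} (\<lambda>s. 1 / (m1 A s)\<^sup>2) * v0 (z t)
        = integral {0..t} (\<lambda>s. 1 / m1 A s)" if "0 \<le> t" for t
      using char[OF that] m1_pos[of t]
      by (simp add: CP_char_def m2_eq[OF A] sigma_sq_eq[OF A])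
  qed (use eps mono pos z m1_cont in \<open>auto simp: m1_def\<close>)
  moreover have "\<Lambda> t = m1 A t / v0 (z t)" if "0 \<le> t" for t
    using rate[OF that] m1_pos[of t] \<Lambda>(2)[OF that] by (simp add: A_def)
  ultimately show ?thesis
    using that unfolding A_def by blast
qed

text \<open>For \<open>t > 0\<close> the variable \<open>X t\<close> has no atom at 0, so the correspondence at \<open>x = 0\<close> reads
  \<open>1 / \<Lambda> = v(0, t) = 1 / E[X\<^sub>t]\<close>.\<close>
lemma CP_evolution_expectation:
  assumes "prob_space M" "CP_evolution M \<epsilon> X \<Lambda> v" "0 < t"
  shows "prob_space.expectation M (X t) = \<Lambda> t"
proof -
  define D where "D = CP_domain \<epsilon> (ess_norm M (X 0)) (\<lambda>x. 1 / mean_residual M (X 0) x)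
    (\<lambda>s. 1 / \<Lambda> s) t"
  have sol: "inviscid_CP_solution \<epsilon> (ess_norm M (X 0)) (\<lambda>x. 1 / mean_residual M (X 0) x) \<Lambda> v"
    and corr: "CP_corresponds M (X t) D (\<lambda>x. v x t)"
    and nz: "AE \<omega> in M. X t \<omega> \<noteq> 0"
    using assms unfolding CP_evolution_def Let_def D_def by auto
  have D: "0 \<in> D" "v 0 t = 1 / \<Lambda> t"
    using sol assms(3) unfolding inviscid_CP_solution_def Let_def D_def by (blast intro: less_imp_le)+
  have "X t \<in> borel_measurable M" "AE \<omega> in M. 0 < X t \<omega>"
    using corr nz unfolding CP_corresponds_def by (auto elim: eventually_elim2)
  then have "prob_space.expectation M (X t) = mean_residual M (X t) 0"
    using mean_residual_zero_eq_expectation[OF assms(1)] by simp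
  also have "\<dots> = \<Lambda> t"
  proof -
    have "v 0 t = 1 / mean_residual M (X t) 0"
      using corr D(1) unfolding CP_corresponds_def by blast
    then show ?thesis
      using D(2) by (metis divide_divide_eq_right div_by_1 mult_1)
  qed
  finally show ?thesis .
qed

lemma eventually_DERIV_ge_of_Liminf:
  fixes f :: "real \<Rightarrow> real"
  assumes "a < b" and f: "\<And>x. a < x \<Longrightarrow> x < b \<Longrightarrow> f differentiable (at x)"
    and lim: "Liminf (at_left b) (\<lambda>x. ereal (deriv f x)) > 0"
  obtains c d where "0 < c" "d < b"
    "\<And>x. d < x \<Longrightarrow> x < b \<Longrightarrow> \<exists>p\<ge>c. (f has_real_derivative p) (at x)"
proof -
  obtain c where c: "0 < ereal c" "ereal c < Liminf (at_left b) (\<lambda>x. ereal (deriv f x))"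
    using ereal_dense2[OF lim] by auto
  from less_LiminfD[OF c(2)] obtain d where d: "d < b"
    "\<And>x. d < x \<Longrightarrow> x < b \<Longrightarrow> c < deriv f x"
    by (auto simp: eventually_at_left_field)
  show ?thesis
  proof (rule that[of c "max a d"])
    fix x
    assume x: "max a d < x" "x < b"
    then have "(f has_real_derivative deriv f x) (at x)"
      using f[of x] by (simp add: DERIV_deriv_iff_real_differentiable)
    then show "\<exists>p\<ge>c. (f has_real_derivative p) (at x)"
      using d(2)[of x] x by (intro exI[of _ "deriv f x"]) auto
  qed (use c d assms(1) in auto)
qed

section \<open>Asymptotics of the mean in the CP model\<close>

theorem theorem1p1:
  fixes M :: "'a measure" and X :: "real \<Rightarrow> 'a \<Rightarrow> real"
    and \<epsilon> x_inf :: real and \<Lambda> :: "real \<Rightarrow> real" and v :: "real \<Rightarrow> real \<Rightarrow> real"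
  assumes "prob_space M"
    and "0 < \<epsilon>"
    and "X 0 \<in> borel_measurable M" and "AE \<omega> in M. 0 \<le> X 0 \<omega>"
    and "\<epsilon> < prob_space.expectation M (X 0)"
    and "ess_norm M (X 0) = ereal x_inf"
    and "antimono_on {0..<x_inf} (mean_residual M (X 0))"
    and "CP_evolution M \<epsilon> X \<Lambda> v"
  shows "((\<lambda>t. prob_space.expectation M (X t) / t) \<longlongrightarrow> 1) at_top \<and>
    ((\<exists>a. 0 \<le> a \<and> a < x_inf \<and>
          mean_residual M (X 0) C1_differentiable_on {a<..<x_inf} \<and>
          convex_on {a<..<x_inf} (mean_residual M (X 0))) \<and>
     Liminf (at_left x_inf) (\<lambda>x. ereal (deriv (\<lambda>y. 1 / mean_residual M (X 0) y) x)) > 0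
     \<longrightarrow>
     (\<exists>C T. C > 0 \<and> T > 0 \<and>
        (\<forall>t\<ge>T. (\<lambda>s. prob_space.expectation M (X s)) differentiable (at t) \<and>
           1 - C / ln t \<le> deriv (\<lambda>s. prob_space.expectation M (X s)) t \<and>
           deriv (\<lambda>s. prob_space.expectation M (X s)) t \<le> 1)))"
proof -
  define v0 where "v0 = (\<lambda>x. 1 / mean_residual M (X 0) x)"
  define E where "E = (\<lambda>t. prob_space.expectation M (X t))"
  have mr_pos: "0 < mean_residual M (X 0) x" if "0 \<le> x" "x < x_inf" for x
    using mean_residual_pos[OF assms(1,3,4,6) that] .
  have v0_pos: "0 < v0 x" if "x \<in> {0..<x_inf}" for x
    using mr_pos that by (simp add: v0_def)
  have v0_mono: "mono_on {0..<x_inf} v0"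
  proof (rule mono_onI)
    fix x y
    assume "x \<in> {0..<x_inf}" "y \<in> {0..<x_inf}" "x \<le> y"
    then show "v0 x \<le> v0 y"
      using monotone_onD[OF assms(7), of x y] mr_pos[of y] by (simp add: v0_def frac_le)
  qed
  have "inviscid_CP_solution \<epsilon> (ereal x_inf) v0 \<Lambda> v"
    using assms(6,8) by (simp add: CP_evolution_def v0_def Let_def)
  from inviscid_CP_origin_characteristic[OF this assms(2) v0_mono v0_pos]
  obtain z where oc: "origin_characteristic \<epsilon> x_inf v0 z (m1 (\<lambda>s. 1 / \<Lambda> s))"
    and \<Lambda>: "\<And>t. 0 \<le> t \<Longrightarrow> \<Lambda> t = m1 (\<lambda>s. 1 / \<Lambda> s) t / v0 (z t)" by blast
  interpret origin_characteristic \<epsilon> x_inf v0 z "m1 (\<lambda>s. 1 / \<Lambda> s)" by fact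
  have E: "E t = mean t" if "0 < t" for t
    using CP_evolution_expectation[OF assms(1,8) that] \<Lambda>[of t] that
    by (simp add: E_def mean_def u_def)
  have "\<forall>\<^sub>F t in at_top. mean t / t = E t / t"
    using eventually_gt_at_top[of 0] by eventually_elim (simp add: E)
  from Lim_transform_eventually[OF mean_over_t_tendsto this]
  have lim: "((\<lambda>t. E t / t) \<longlongrightarrow> 1) at_top" .
  have "\<exists>C T. C > 0 \<and> T > 0 \<and>
      (\<forall>t\<ge>T. E differentiable (at t) \<and> 1 - C / ln t \<le> deriv E t \<and> deriv E t \<le> 1)"
    if a: "0 \<le> a" "a < x_inf" "mean_residual M (X 0) C1_differentiable_on {a<..<x_inf}"
      and liminf: "Liminf (at_left x_inf) (\<lambda>x. ereal (deriv v0 x)) > 0" for a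
  proof -
    have "v0 differentiable (at x)" if "a < x" "x < x_inf" for x
    proof -
      have "mean_residual M (X 0) differentiable (at x)"
        using a(3) that by (simp add: C1_differentiable_on_eq)
      then show ?thesis
        unfolding v0_def using mr_pos[of x] a(1) that by (intro derivative_intros) auto
    qed
    from eventually_DERIV_ge_of_Liminf[OF a(2) this liminf]
    obtain c b where "0 < c" "b < x_inf"
      "\<And>x. b < x \<Longrightarrow> x < x_inf \<Longrightarrow> \<exists>p\<ge>c. (v0 has_real_derivative p) (at x)" by blast
    from mean_deriv_bounds[OF this(2,1,3)]
    obtain C T where C: "0 < C" "1 < T"
      and D: "\<And>t. T \<le> t \<Longrightarrow> \<exists>D. (mean has_real_derivative D) (at t) \<and> 1 - C / ln t \<le> D \<and> D \<le> 1"
      by blast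
    have "E differentiable (at t) \<and> 1 - C / ln t \<le> deriv E t \<and> deriv E t \<le> 1"
      if t: "T \<le> t" for t
    proof -
      obtain D where D': "(mean has_real_derivative D) (at t)" "1 - C / ln t \<le> D" "D \<le> 1"
        using D[OF t] by blast
      have "(E has_real_derivative D) (at t)"
        by (rule has_field_derivative_transform_within_open[OF D'(1), of "{0<..}"])
           (use E t C in auto)
      then show ?thesis
        using D'(2,3) DERIV_imp_deriv real_differentiable_def by metis
    qed
    then show ?thesis
      using C by (intro exI[of _ C] exI[of _ T]) auto
  qed
  then show ?thesis
    using lim unfolding E_def v0_def by blast
qed
end
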